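(* Let $W$ denote the wicket. If a linear $3$-uniform hypergraph contains no wicket, then it is sparse, that is, $ex_L(n,W)=o(n^2)$ as $n\to\infty$. Equivalently, for every $c>0$ there is an $n_0$ such that for all $n\ge n_0$ every linear $3$-uniform hypergraph on $n$ vertices containing no subgraph isomorphic to $W$ has fewer than $cn^2$ edges.
   Context: A $3$-uniform hypergraph is a hypergraph all of whose edges have exactly three vertices. A hypergraph is linear if any two distinct edges have at most one vertex in common. For a linear $3$-uniform hypergraph $F$, the Turán number $ex_L(n,F)$ is the maximum number of edges of a linear $3$-uniform hypergraph on $n$ vertices that does not contain a (not necessarily induced) subgraph isomorphic to $F$. The wicket $W$ is the linear $3$-uniform hypergraph with nine vertices and five edges formed by the three rows and two of the columns of a $3\times 3$ matrix of points: its vertices are $p_{ij}$ with $1\le i,j\le 3$, and its edges are $\{p_{i1},p_{i2},p_{i3}\}$ for $i=1,2,3$ and $\{p_{1j},p_{2j},p_{3j}\}$ for $j=1,2$. *)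

theory Defs
  imports Complex_Main "HOL-Library.Landau_Symbols"
begin

record 'a hypergraph =
  verts :: "'a set"
  edges :: "'a set set"

definition finite_hypergraph :: "'a hypergraph \<Rightarrow> bool" where
  "finite_hypergraph H \<longleftrightarrow> finite (verts H) \<and> (\<forall>e\<in>edges H. e \<subseteq> verts H)"

definition three_uniform :: "'a hypergraph \<Rightarrow> bool" where
  "three_uniform H \<longleftrightarrow> (\<forall>e\<in>edges H. card e = 3)"

definition linear_hypergraph :: "'a hypergraph \<Rightarrow> bool" where
  "linear_hypergraph H \<longleftrightarrow>
     (\<forall>e\<in>edges H. \<forall>e'\<in>edges H. e \<noteq> e' \<longrightarrow> card (e \<inter> e') \<le> 1)"

definition linear_3_graph :: "'a hypergraph \<Rightarrow> bool" where
  "linear_3_graph H \<longleftrightarrow> finite_hypergraph H \<and> three_uniform H \<and> linear_hypergraph H"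

definition subhypergraph :: "'a hypergraph \<Rightarrow> 'a hypergraph \<Rightarrow> bool" where
  "subhypergraph H' H \<longleftrightarrow>
     finite_hypergraph H' \<and> verts H' \<subseteq> verts H \<and> edges H' \<subseteq> edges H"

definition isomorphic :: "'a hypergraph \<Rightarrow> 'b hypergraph \<Rightarrow> bool" where
  "isomorphic F G \<longleftrightarrow>
     (\<exists>f. bij_betw f (verts F) (verts G) \<and> (\<lambda>e. f ` e) ` edges F = edges G)"

definition contains_copy :: "'a hypergraph \<Rightarrow> 'b hypergraph \<Rightarrow> bool" where
  "contains_copy H F \<longleftrightarrow> (\<exists>H'. subhypergraph H' H \<and> isomorphic F H')"

text \<open>
  Vertices may be taken to be natural numbers, as every finite hypergraph is isomorphic to one
  on such vertices. If \<open>F\<close> has an edge, the maximum is over a finite nonempty set (see below).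
\<close>

definition ex_L :: "nat \<Rightarrow> 'b hypergraph \<Rightarrow> nat" where
  "ex_L n F = Max {card (edges H) | H :: nat hypergraph.
     linear_3_graph H \<and> card (verts H) = n \<and> \<not> contains_copy H F}"

definition wicket :: "(nat \<times> nat) hypergraph" where
  "wicket = \<lparr>verts = {1..3} \<times> {1..3},
             edges = (\<lambda>i. {(i, 1), (i, 2), (i, 3)}) ` {1..3} \<union>
                     (\<lambda>j. {(1, j), (2, j), (3, j)}) ` {1..2}\<rparr>"

lemma finite_ex_L_set:
  "finite {card (edges H) | H :: nat hypergraph.
     linear_3_graph H \<and> card (verts H) = n \<and> \<not> contains_copy H F}"
proof (rule finite_subset)
  show "{card (edges H) | H :: nat hypergraph.
     linear_3_graph H \<and> card (verts H) = n \<and> \<not> contains_copy H F} \<subseteq> {..2 ^ n}"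
  proof clarsimp
    fix H :: "nat hypergraph"
    assume "linear_3_graph H"
    then have fin: "finite (verts H)" and "edges H \<subseteq> Pow (verts H)"
      by (auto simp: linear_3_graph_def finite_hypergraph_def)
    then have "card (edges H) \<le> card (Pow (verts H))"
      by (intro card_mono) auto
    then show "card (edges H) \<le> 2 ^ card (verts H)"
      using fin by (simp add: card_Pow)
  qed
qed simp

lemma ex_L_set_nonempty:
  assumes "edges F \<noteq> {}"
  shows "{card (edges H) | H :: nat hypergraph.
     linear_3_graph H \<and> card (verts H) = n \<and> \<not> contains_copy H F} \<noteq> {}"
proof -
  let ?H = "\<lparr>verts = {..<n}, edges = {}\<rparr> :: nat hypergraph"
  have "linear_3_graph ?H"
    by (simp add: linear_3_graph_def finite_hypergraph_def three_uniform_def linear_hypergraph_def)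
  moreover have "\<not> contains_copy ?H F"
    using assms by (auto simp: contains_copy_def subhypergraph_def isomorphic_def)
  moreover have "card (verts ?H) = n" by simp
  ultimately show ?thesis by blast
qed

lemma linear_3_graph_wicket: "linear_3_graph wicket"
proof -
  have 1: "{1..3::nat} = {1, 2, 3}" "{1..2::nat} = {1, 2}" by auto
  show ?thesis
    unfolding linear_3_graph_def finite_hypergraph_def three_uniform_def linear_hypergraph_def
      wicket_def 1
    by (simp add: Int_insert_left)
qed

lemma wicket_size: "card (verts wicket) = 9" "card (edges wicket) = 5"
proof -
  have 1: "{1..3::nat} = {1, 2, 3}" "{1..2::nat} = {1, 2}" by auto
  show "card (verts wicket) = 9" by (simp add: wicket_def)
  show "card (edges wicket) = 5"
    unfolding wicket_def 1 by (simp add: set_eq_subset card_insert_if)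
qed

end

theory Submission
  imports Defs
begin

text \<open>
  Fix a linear 3-uniform hypergraph with vertex set \<open>V\<close> of size \<open>n\<close>. Call \<open>(a, b)\<close> a shadow pair if some
  edge contains both vertices. By linearity that edge has a unique third vertex, the \<^emph>\<open>colour\<close> of the
  pair, and the shadow pairs of one colour form a matching. A wicket with columns \<open>{a, b', x}\<close> and
  \<open>{a', b, y}\<close> is the following coloured pattern: \<open>(a, b)\<close> is a shadow pair (the first row), the pair
  of colour \<open>x\<close> at \<open>a\<close> leads to \<open>b'\<close>, where a pair of colour \<open>y\<close> starts, and the pair of colour \<open>y\<close>
  at \<open>b\<close> leads to \<open>a'\<close>, where a pair of colour \<open>x\<close> starts.

  The tool is a cleaning lemma of Ruzsa-Szemeredi type (\<open>matching_cleaning\<close>): after deleting at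
  most \<open>\<delta> n\<^sup>2\<close> pairs from a relation \<open>R\<close>, any matching of linear size among the remaining pairs spans
  quadratically many pairs of \<open>R\<close> between its two sides. It follows from a one-sided form of
  Szemeredi's regularity lemma, proved by energy increment.

  If there are \<open>c n\<^sup>2\<close> edges, cleaning is applied twice, to the set \<open>R\<close> of shadow pairs and then to what
  is left of it. Some colour \<open>x\<close> still has a matching of linear size after both deletions. This matching
  spans \<open>\<zeta>1 n\<^sup>2\<close> pairs \<open>(a', b')\<close> that survived the first deletion, and so linearly many of a single
  colour \<open>y \<noteq> x\<close>. Each of them is the middle of a path \<open>a, b', a', b''\<close> with colours \<open>x, y, x\<close>. The
  first pairs of these paths again form a matching of linear size among the pairs that survived the
  first deletion, so it spans quadratically many pairs of \<open>R\<close>. Each such pair \<open>(a, b)\<close> is the first row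
  in the pattern above, and only linearly many of them give coinciding vertices.

  The order of choosing constants matters: \<open>\<zeta>1\<close> depends on \<open>c\<close> alone, and it determines how long the
  matchings must be that the first deletion has to handle.
\<close>

section \<open>Averaging over the fibers of a function\<close>

definition cond_avg :: "'a set \<Rightarrow> ('a \<Rightarrow> 'k) \<Rightarrow> ('a \<Rightarrow> real) \<Rightarrow> 'a \<Rightarrow> real" where
  "cond_avg \<Omega> \<kappa> g x = sum g {y\<in>\<Omega>. \<kappa> y = \<kappa> x} / real (card {y\<in>\<Omega>. \<kappa> y = \<kappa> x})"

lemma cond_avg_cong: "\<kappa> x = \<kappa> y \<Longrightarrow> cond_avg \<Omega> \<kappa> g x = cond_avg \<Omega> \<kappa> g y"
  by (simp add: cond_avg_def)

text \<open>
  On a single fiber \<open>h\<close> is a constant and the average has the same sum as \<open>g\<close>.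
\<close>

lemma sum_mult_cond_avg:
  assumes fin: "finite \<Omega>"
    and h: "\<And>x y. x \<in> \<Omega> \<Longrightarrow> y \<in> \<Omega> \<Longrightarrow> \<kappa> x = \<kappa> y \<Longrightarrow> h x = h y"
  shows "(\<Sum>x\<in>\<Omega>. h x * cond_avg \<Omega> \<kappa> g x) = (\<Sum>x\<in>\<Omega>. h x * g x)"
proof -
  have "(\<Sum>x\<in>{x\<in>\<Omega>. \<kappa> x = k}. h x * cond_avg \<Omega> \<kappa> g x) = (\<Sum>x\<in>{x\<in>\<Omega>. \<kappa> x = k}. h x * g x)"
    if k: "k \<in> \<kappa> ` \<Omega>" for k
  proof -
    obtain z where z: "z \<in> \<Omega>" "k = \<kappa> z" using k by auto
    let ?S = "{x\<in>\<Omega>. \<kappa> x = \<kappa> z}"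
    have "card ?S \<noteq> 0" using z fin by auto
    then have "(\<Sum>x\<in>?S. h x * cond_avg \<Omega> \<kappa> g x) = (\<Sum>x\<in>?S. h z * (sum g ?S / real (card ?S)))"
      by (intro sum.cong refl) (auto simp: cond_avg_def intro: arg_cong2[where f="(*)"] h z)
    also have "\<dots> = h z * sum g ?S" using \<open>card ?S \<noteq> 0\<close> by simp
    also have "\<dots> = (\<Sum>x\<in>?S. h x * g x)"
      unfolding sum_distrib_left by (intro sum.cong refl) (metis (mono_tags, lifting) h mem_Collect_eq z(1))
    finally show ?thesis using z by simp
  qed
  then show ?thesis
    by (subst (1 2) sum.image_gen[OF fin, where g=\<kappa>]) (rule sum.cong[OF refl])
qed

text \<open>
  The average is an orthogonal projection, and the coarser one factors through the finer one: testing
  both against the coarser average gives the same inner product.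
\<close>

lemma cond_avg_pythagoras:
  assumes fin: "finite \<Omega>"
    and ref: "\<And>x y. x \<in> \<Omega> \<Longrightarrow> y \<in> \<Omega> \<Longrightarrow> \<kappa>' x = \<kappa>' y \<Longrightarrow> \<kappa> x = \<kappa> y"
  shows "(\<Sum>x\<in>\<Omega>. (cond_avg \<Omega> \<kappa>' g x)\<^sup>2)
       = (\<Sum>x\<in>\<Omega>. (cond_avg \<Omega> \<kappa> g x)\<^sup>2) + (\<Sum>x\<in>\<Omega>. (cond_avg \<Omega> \<kappa>' g x - cond_avg \<Omega> \<kappa> g x)\<^sup>2)"
proof -
  let ?E = "cond_avg \<Omega> \<kappa> g" and ?E' = "cond_avg \<Omega> \<kappa>' g"
  have 1: "(\<Sum>x\<in>\<Omega>. ?E x * ?E' x) = (\<Sum>x\<in>\<Omega>. ?E x * g x)"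
    by (rule sum_mult_cond_avg[OF fin]) (metis cond_avg_cong ref)
  have 2: "(\<Sum>x\<in>\<Omega>. ?E x * ?E x) = (\<Sum>x\<in>\<Omega>. ?E x * g x)"
    by (rule sum_mult_cond_avg[OF fin]) (metis cond_avg_cong)
  have "(\<Sum>x\<in>\<Omega>. (?E' x - ?E x)\<^sup>2)
      = (\<Sum>x\<in>\<Omega>. (?E' x)\<^sup>2) - 2 * (\<Sum>x\<in>\<Omega>. ?E x * ?E' x) + (\<Sum>x\<in>\<Omega>. ?E x * ?E x)"
    unfolding sum_distrib_left sum_subtractf[symmetric] sum.distrib[symmetric]
    by (intro sum.cong refl) (simp add: power2_eq_square algebra_simps)
  then show ?thesis using 1 2 by (simp add: power2_eq_square)
qed

lemma cond_avg_unit_interval: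
  assumes "\<And>y. 0 \<le> g y" "\<And>y. g y \<le> (1::real)"
  shows "0 \<le> cond_avg \<Omega> \<kappa> g x" "cond_avg \<Omega> \<kappa> g x \<le> 1"
proof -
  let ?S = "{y\<in>\<Omega>. \<kappa> y = \<kappa> x}"
  show "0 \<le> cond_avg \<Omega> \<kappa> g x" by (auto simp: cond_avg_def intro!: divide_nonneg_nonneg sum_nonneg assms)
  have "sum g ?S \<le> real (card ?S)" using sum_bounded_above[of ?S g 1] assms by simp
  then show "cond_avg \<Omega> \<kappa> g x \<le> 1"
    unfolding cond_avg_def by (cases "card ?S = 0") (auto simp: divide_le_eq_1 simp del: card_eq_0_iff)
qed

section \<open>One-sided regularity by energy increment\<close>

text \<open>
  Partitions of \<open>V\<close> are generated by finite families \<open>F\<close> of sets, two vertices being equivalent if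
  they lie in the same members of \<open>F\<close>. Refining a partition then just means enlarging the family.
\<close>

definition trace :: "'a set set \<Rightarrow> 'a \<Rightarrow> 'a set set" where
  "trace F v = {A\<in>F. v \<in> A}"

lemma trace_eq_subset:
  assumes "F \<subseteq> F'" "trace F' u = trace F' v"
  shows "trace F u = trace F v"
proof -
  have "trace F w = F \<inter> trace F' w" for w
    using assms(1) by (auto simp: trace_def)
  then show ?thesis using assms(2) by simp
qed

definition atom :: "'a set \<Rightarrow> 'a set set \<Rightarrow> 'a \<Rightarrow> 'a set" where
  "atom V F v = {u\<in>V. trace F u = trace F v}"

definition density :: "'a set \<Rightarrow> ('a \<times> 'a) set \<Rightarrow> 'a set set \<Rightarrow> 'a set set \<Rightarrow> 'a \<times> 'a \<Rightarrow> real" where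
  "density V R F K = cond_avg (V \<times> V) (map_prod (trace F) (trace K)) (\<lambda>p. of_bool (p \<in> R))"

lemma density_cong:
  "trace F v = trace F v' \<Longrightarrow> trace K w = trace K w' \<Longrightarrow> density V R F K (v, w) = density V R F K (v', w')"
  unfolding density_def by (rule cond_avg_cong) simp

definition energy :: "'a set \<Rightarrow> ('a \<times> 'a) set \<Rightarrow> 'a set set \<Rightarrow> 'a set set \<Rightarrow> real" where
  "energy V R F K = (\<Sum>p\<in>V \<times> V. (density V R F K p)\<^sup>2)"

text \<open>
  \<open>W\<close> is a witness that the cell of \<open>p\<close> is not regular: a pair of large subsets of the two atoms
  between which the density is too small by \<open>\<gamma>\<close>. Too large a density is not counted as a defect, since
  only lower bounds on the number of pairs will be drawn from regularity.
\<close>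

definition deficient ::
  "'a set \<Rightarrow> ('a \<times> 'a) set \<Rightarrow> real \<Rightarrow> real \<Rightarrow> 'a set set \<Rightarrow> 'a set set \<Rightarrow> 'a \<times> 'a \<Rightarrow> 'a set \<times> 'a set \<Rightarrow> bool" where
  "deficient V R \<epsilon> \<gamma> F K p W \<longleftrightarrow>
     fst W \<subseteq> atom V F (fst p) \<and> snd W \<subseteq> atom V K (snd p) \<and>
     real (card (fst W)) \<ge> \<epsilon> * real (card (atom V F (fst p))) \<and>
     real (card (snd W)) \<ge> \<epsilon> * real (card (atom V K (snd p))) \<and>
     real (card (R \<inter> fst W \<times> snd W)) < (density V R F K p - \<gamma>) * real (card (fst W)) * real (card (snd W))"

definition irregular_pairs ::
  "'a set \<Rightarrow> ('a \<times> 'a) set \<Rightarrow> real \<Rightarrow> real \<Rightarrow> 'a set set \<Rightarrow> 'a set set \<Rightarrow> ('a \<times> 'a) set" where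
  "irregular_pairs V R \<epsilon> \<gamma> F K = {p \<in> V \<times> V. \<exists>W. deficient V R \<epsilon> \<gamma> F K p W}"

lemma deficient_cong:
  assumes "trace F v = trace F v'" "trace K w = trace K w'"
  shows "deficient V R \<epsilon> \<gamma> F K (v, w) = deficient V R \<epsilon> \<gamma> F K (v', w')"
  using assms density_cong[OF assms, of V R]
  by (intro ext) (simp add: deficient_def atom_def)

lemma sum_density_over_box:
  assumes fin: "finite V" and sub: "X \<subseteq> V" "Y \<subseteq> V" and mem: "X \<in> F" "Y \<in> K"
  shows "(\<Sum>p\<in>X \<times> Y. density V R F K p) = real (card (R \<inter> X \<times> Y))"
proof -
  let ?h = "\<lambda>p. of_bool (p \<in> X \<times> Y) :: real"
  have "(\<Sum>p\<in>V\<times>V. ?h p * density V R F K p) = (\<Sum>p\<in>V\<times>V. ?h p * of_bool (p \<in> R))"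
    unfolding density_def
    by (rule sum_mult_cond_avg) (use fin mem in \<open>auto simp: trace_def\<close>)
  moreover have "(V \<times> V) \<inter> {p. p \<in> X \<times> Y} = X \<times> Y" using sub by auto
  moreover have "finite X" "finite Y" using fin sub finite_subset by auto
  ultimately show ?thesis
    using fin by (simp add: sum_of_bool_mult_eq Int_commute Collect_conj_eq[symmetric])
qed

lemma card_trace_image_le: "finite F \<Longrightarrow> card (trace F ` V) \<le> 2 ^ card F"
  by (subst card_Pow[symmetric]) (auto simp: trace_def intro!: card_mono)


text \<open>
  For each irregular cell, add the two sets of one witness to the families. In the refined partition
  the witness box is a union of cells, so over it the density drops by more than \<open>\<gamma>\<close> on average,
  and by the Pythagorean identity the squares of these changes are exactly the gain in energy.
\<close>

lemma energy_increment:
  assumes fin: "finite V" "finite F" "finite K" and pos: "0 < \<epsilon>" "0 < \<gamma>"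
  shows "\<exists>F' K'. finite F' \<and> finite K' \<and>
    card F' \<le> card F + 2 ^ (card F + card K) \<and> card K' \<le> card K + 2 ^ (card F + card K) \<and>
    energy V R F K + \<gamma>\<^sup>2 * \<epsilon>\<^sup>2 * real (card (irregular_pairs V R \<epsilon> \<gamma> F K)) \<le> energy V R F' K'"
proof -
  let ?\<Omega> = "V \<times> V" and ?B = "irregular_pairs V R \<epsilon> \<gamma> F K"
  define \<kappa> where "\<kappa> = map_prod (trace F) (trace K)"
  \<comment> \<open>The witness is chosen per cell rather than per pair, so that only boundedly many sets are added.\<close>
  define w where "w k = (SOME W. \<exists>p\<in>?\<Omega>. \<kappa> p = k \<and> deficient V R \<epsilon> \<gamma> F K p W)" for k
  define F' where "F' = F \<union> (\<lambda>k. fst (w k)) ` \<kappa> ` ?\<Omega>"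
  define K' where "K' = K \<union> (\<lambda>k. snd (w k)) ` \<kappa> ` ?\<Omega>"
  define \<kappa>' where "\<kappa>' = map_prod (trace F') (trace K')"
  define D where "D p = density V R F' K' p - density V R F K p" for p
  have fin\<Omega>: "finite ?\<Omega>" using fin by simp
  have w: "deficient V R \<epsilon> \<gamma> F K p (w (\<kappa> p))" if p: "p \<in> ?B" for p
  proof -
    have "\<exists>W. \<exists>q\<in>?\<Omega>. \<kappa> q = \<kappa> p \<and> deficient V R \<epsilon> \<gamma> F K q W"
      using p by (auto simp: irregular_pairs_def)
    then have "\<exists>q\<in>?\<Omega>. \<kappa> q = \<kappa> p \<and> deficient V R \<epsilon> \<gamma> F K q (w (\<kappa> p))"
      unfolding w_def by (rule someI_ex)
    then obtain q where "\<kappa> q = \<kappa> p" "deficient V R \<epsilon> \<gamma> F K q (w (\<kappa> p))" by blast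
    then show ?thesis
      using deficient_cong[of F "fst q" "fst p" K "snd q" "snd p" V R \<epsilon> \<gamma>]
      by (cases p; cases q) (simp add: \<kappa>_def)
  qed
  have "card (\<kappa> ` ?\<Omega>) \<le> card (trace F ` V \<times> trace K ` V)"
    using fin by (intro card_mono) (auto simp: \<kappa>_def)
  also have "\<dots> \<le> 2 ^ card F * 2 ^ card K"
    unfolding card_cartesian_product by (intro mult_mono card_trace_image_le fin) auto
  finally have cells: "card (\<kappa> ` ?\<Omega>) \<le> 2 ^ (card F + card K)" by (simp add: power_add)
  have new: "card (f ` \<kappa> ` ?\<Omega>) \<le> 2 ^ (card F + card K)" for f :: "_ \<Rightarrow> 'a set"
    using card_image_le[of "\<kappa> ` ?\<Omega>" f] cells fin\<Omega> by simp
  have cards: "card F' \<le> card F + 2 ^ (card F + card K)" "card K' \<le> card K + 2 ^ (card F + card K)"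
    unfolding F'_def K'_def
    by (rule order_trans[OF card_Un_le add_left_mono[OF new]])+
  have fin': "finite F'" "finite K'" using fin by (auto simp: F'_def K'_def)
  have local_gain: "\<gamma>\<^sup>2 * \<epsilon>\<^sup>2 * (\<Sum>p\<in>{p\<in>?\<Omega>. \<kappa> p = k}. of_bool (p \<in> ?B))
      \<le> (\<Sum>p\<in>{p\<in>?\<Omega>. \<kappa> p = k}. (D p)\<^sup>2)" for k
  proof (cases "\<exists>p\<in>?\<Omega>. \<kappa> p = k \<and> p \<in> ?B")
    case False
    then have "(\<Sum>p\<in>{p\<in>?\<Omega>. \<kappa> p = k}. of_bool (p \<in> ?B) :: real) = 0"
      by (intro sum.neutral) auto
    then show ?thesis by (simp add: sum_nonneg del: sum_of_bool_eq)
  next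
    case True
    then obtain p where p: "p \<in> ?\<Omega>" "\<kappa> p = k" "p \<in> ?B" by blast
    define P Q X Y where "P = atom V F (fst p)" and "Q = atom V K (snd p)"
      and "X = fst (w k)" and "Y = snd (w k)"
    have fiber: "{q\<in>?\<Omega>. \<kappa> q = k} = P \<times> Q"
      using p(2) by (cases p) (auto simp: P_def Q_def atom_def \<kappa>_def)
    have def: "X \<subseteq> P" "Y \<subseteq> Q" "\<epsilon> * real (card P) \<le> real (card X)" "\<epsilon> * real (card Q) \<le> real (card Y)"
      "real (card (R \<inter> X \<times> Y)) < (density V R F K p - \<gamma>) * real (card X) * real (card Y)"
      using w[OF p(3)] p(2) by (auto simp: deficient_def P_def Q_def X_def Y_def)
    have PV: "P \<subseteq> V" "Q \<subseteq> V" by (auto simp: P_def Q_def atom_def)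
    then have finPQ: "finite P" "finite Q" using fin finite_subset by auto
    have "(\<Sum>q\<in>X\<times>Y. density V R F K q) = (\<Sum>q\<in>X\<times>Y. density V R F K p)"
    proof (rule sum.cong[OF refl])
      fix q assume "q \<in> X \<times> Y"
      then have "q \<in> P \<times> Q" using def by auto
      then show "density V R F K q = density V R F K p"
        using density_cong[of F "fst q" "fst p" K "snd q" "snd p" V R]
        by (auto simp: P_def Q_def atom_def)
    qed
    moreover have "(\<Sum>q\<in>X\<times>Y. density V R F' K' q) = real (card (R \<inter> X \<times> Y))"
      by (rule sum_density_over_box) (use def PV p fin in \<open>auto simp: F'_def K'_def X_def Y_def\<close>)
    ultimately have sumD: "(\<Sum>q\<in>X\<times>Y. D q) < - \<gamma> * (real (card X) * real (card Y))"
      using def(5) by (simp add: D_def sum_subtractf card_cartesian_product algebra_simps)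
    have "\<gamma>\<^sup>2 * \<epsilon>\<^sup>2 * (\<Sum>q\<in>P\<times>Q. of_bool (q \<in> ?B)) \<le> \<gamma>\<^sup>2 * \<epsilon>\<^sup>2 * (\<Sum>q\<in>P\<times>Q. 1)"
      by (intro mult_left_mono sum_mono) auto
    also have "\<dots> = \<gamma>\<^sup>2 * ((\<epsilon> * real (card P)) * (\<epsilon> * real (card Q)))"
      by (simp add: card_cartesian_product power2_eq_square)
    also have "\<dots> \<le> \<gamma>\<^sup>2 * (real (card X) * real (card Y))"
      using pos def by (intro mult_left_mono mult_mono) auto
    also have "\<dots> = -2 * \<gamma> * (- \<gamma> * (real (card X) * real (card Y))) - \<gamma>\<^sup>2 * real (card (X \<times> Y))"
      by (simp add: card_cartesian_product power2_eq_square)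
    also have "\<dots> \<le> -2 * \<gamma> * (\<Sum>q\<in>X\<times>Y. D q) - \<gamma>\<^sup>2 * real (card (X \<times> Y))"
      using mult_left_mono[OF less_imp_le[OF sumD], of "2 * \<gamma>"] pos by simp
    also have "\<dots> = (\<Sum>q\<in>X\<times>Y. -2 * \<gamma> * D q - \<gamma>\<^sup>2)"
      by (simp add: sum_subtractf sum_distrib_left)
    also have "\<dots> \<le> (\<Sum>q\<in>X\<times>Y. (D q)\<^sup>2)"
      \<comment> \<open>the linear bound takes the place of the Cauchy-Schwarz inequality\<close>
    proof (rule sum_mono)
      fix q show "-2 * \<gamma> * D q - \<gamma>\<^sup>2 \<le> (D q)\<^sup>2"
        using zero_le_power2[of "D q + \<gamma>"] by (simp add: power2_eq_square algebra_simps)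
    qed
    also have "\<dots> \<le> (\<Sum>q\<in>P\<times>Q. (D q)\<^sup>2)"
      using finPQ def by (intro sum_mono2) auto
    finally show ?thesis unfolding fiber .
  qed
  have "\<gamma>\<^sup>2 * \<epsilon>\<^sup>2 * real (card ?B) = \<gamma>\<^sup>2 * \<epsilon>\<^sup>2 * (\<Sum>p\<in>?\<Omega>. of_bool (p \<in> ?B))"
  proof -
    have "?\<Omega> \<inter> {p. p \<in> ?B} = ?B" by (auto simp: irregular_pairs_def)
    then show ?thesis using fin by simp
  qed
  also have "\<dots> = (\<Sum>k\<in>\<kappa> ` ?\<Omega>. \<gamma>\<^sup>2 * \<epsilon>\<^sup>2 * (\<Sum>p\<in>{p\<in>?\<Omega>. \<kappa> p = k}. of_bool (p \<in> ?B)))"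
    unfolding sum_distrib_left[symmetric] by (subst sum.image_gen[OF fin\<Omega>, where g=\<kappa>]) rule
  also have "\<dots> \<le> (\<Sum>k\<in>\<kappa> ` ?\<Omega>. \<Sum>p\<in>{p\<in>?\<Omega>. \<kappa> p = k}. (D p)\<^sup>2)"
    by (rule sum_mono[OF local_gain])
  also have "\<dots> = (\<Sum>p\<in>?\<Omega>. (D p)\<^sup>2)"
    by (rule sum.image_gen[OF fin\<Omega>, symmetric])
  also have "\<dots> = energy V R F' K' - energy V R F K"
  proof -
    have refines: "\<kappa> p = \<kappa> q" if "\<kappa>' p = \<kappa>' q" for p q
      using that trace_eq_subset[of F F' "fst p" "fst q"] trace_eq_subset[of K K' "snd p" "snd q"]
      by (simp add: \<kappa>_def \<kappa>'_def prod_eq_iff F'_def K'_def)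
    show ?thesis
      using cond_avg_pythagoras[of ?\<Omega> \<kappa>' \<kappa> "\<lambda>p. of_bool (p \<in> R)", OF fin\<Omega> refines]
      by (simp add: energy_def D_def density_def \<kappa>_def \<kappa>'_def)
  qed
  finally show ?thesis using cards fin' by (intro exI[of _ F'] exI[of _ K']) auto
qed

lemma energy_le:
  assumes "finite V"
  shows "energy V R F K \<le> (real (card V))\<^sup>2"
proof -
  have "energy V R F K \<le> (\<Sum>p\<in>V\<times>V. 1)"
    unfolding energy_def density_def
    by (intro sum_mono power_le_one cond_avg_unit_interval) auto
  then show ?thesis by (simp add: card_cartesian_product power2_eq_square)
qed

text \<open>
  The energy is at most \<open>n\<^sup>2\<close>, and each increment adds at least \<open>\<gamma>\<^sup>2 \<epsilon>\<^sup>2 \<beta> n\<^sup>2\<close> as long as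
  more than \<open>\<beta> n\<^sup>2\<close> pairs are irregular; so this stops after a number of rounds independent of \<open>V\<close>
  and \<open>R\<close>.
\<close>

lemma regular_families_exist:
  assumes pos: "0 < \<epsilon>" "0 < \<gamma>" "0 < \<beta>"
  shows "\<exists>N. \<forall>(V :: 'a set) R. finite V \<longrightarrow>
    (\<exists>F K. finite F \<and> finite K \<and> card F \<le> N \<and> card K \<le> N \<and>
       real (card (irregular_pairs V R \<epsilon> \<gamma> F K)) \<le> \<beta> * (real (card V))\<^sup>2)"
proof -
  define c where "c = \<gamma>\<^sup>2 * \<epsilon>\<^sup>2 * \<beta>"
  have c: "0 < c" using pos by (simp add: c_def)
  have step: "\<exists>N. \<forall>(V :: 'a set) R. finite V \<longrightarrow>
    (\<exists>F K. finite F \<and> finite K \<and> card F \<le> N \<and> card K \<le> N \<and>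
       (real (card (irregular_pairs V R \<epsilon> \<gamma> F K)) \<le> \<beta> * (real (card V))\<^sup>2 \<or>
        real i * c * (real (card V))\<^sup>2 \<le> energy V R F K))" for i :: nat
  proof (induction i)
    case 0
    show ?case
      by (rule exI[of _ 0]) (auto simp: energy_def intro!: exI[of _ "{}"] sum_nonneg)
  next
    case (Suc i)
    then obtain N where N: "\<And>(V :: 'a set) R. finite V \<Longrightarrow>
      \<exists>F K. finite F \<and> finite K \<and> card F \<le> N \<and> card K \<le> N \<and>
       (real (card (irregular_pairs V R \<epsilon> \<gamma> F K)) \<le> \<beta> * (real (card V))\<^sup>2 \<or>
        real i * c * (real (card V))\<^sup>2 \<le> energy V R F K)" by meson
    show ?case
    proof (rule exI[of _ "N + 2 ^ (N + N)"], intro allI impI)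
      fix V :: "'a set" and R assume V: "finite V"
      obtain F K where FK: "finite F" "finite K" "card F \<le> N" "card K \<le> N"
        and alt: "real (card (irregular_pairs V R \<epsilon> \<gamma> F K)) \<le> \<beta> * (real (card V))\<^sup>2 \<or>
          real i * c * (real (card V))\<^sup>2 \<le> energy V R F K"
        using N[OF V, of R] by blast
      show "\<exists>F K. finite F \<and> finite K \<and> card F \<le> N + 2 ^ (N + N) \<and> card K \<le> N + 2 ^ (N + N) \<and>
       (real (card (irregular_pairs V R \<epsilon> \<gamma> F K)) \<le> \<beta> * (real (card V))\<^sup>2 \<or>
        real (Suc i) * c * (real (card V))\<^sup>2 \<le> energy V R F K)"
      proof (cases "real (card (irregular_pairs V R \<epsilon> \<gamma> F K)) \<le> \<beta> * (real (card V))\<^sup>2")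
        case True
        then show ?thesis using FK by (intro exI[of _ F] exI[of _ K]) auto
      next
        case False
        obtain F' K' where F'K': "finite F'" "finite K'"
          "card F' \<le> card F + 2 ^ (card F + card K)" "card K' \<le> card K + 2 ^ (card F + card K)"
          "energy V R F K + \<gamma>\<^sup>2 * \<epsilon>\<^sup>2 * real (card (irregular_pairs V R \<epsilon> \<gamma> F K)) \<le> energy V R F' K'"
          using energy_increment[OF V FK(1,2) pos(1,2), of R] by blast
        have "(2::nat) ^ (card F + card K) \<le> 2 ^ (N + N)"
          using FK by (intro power_increasing) auto
        then have "card F' \<le> N + 2 ^ (N + N)" "card K' \<le> N + 2 ^ (N + N)"
          using F'K' FK by linarith+
        moreover have "c * (real (card V))\<^sup>2 \<le> \<gamma>\<^sup>2 * \<epsilon>\<^sup>2 * real (card (irregular_pairs V R \<epsilon> \<gamma> F K))"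
          unfolding c_def mult.assoc using False by (intro mult_left_mono) auto
        then have "real (Suc i) * c * (real (card V))\<^sup>2 \<le> energy V R F' K'"
          using F'K'(5) alt False by (simp add: algebra_simps)
        ultimately show ?thesis using F'K' by (intro exI[of _ F'] exI[of _ K']) auto
      qed
    qed
  qed
  obtain i :: nat where i: "1 < real i * c"
    using c reals_Archimedean3 by blast
  obtain N where N: "\<And>(V :: 'a set) R. finite V \<Longrightarrow>
      \<exists>F K. finite F \<and> finite K \<and> card F \<le> N \<and> card K \<le> N \<and>
       (real (card (irregular_pairs V R \<epsilon> \<gamma> F K)) \<le> \<beta> * (real (card V))\<^sup>2 \<or>
        real i * c * (real (card V))\<^sup>2 \<le> energy V R F K)" using step[of i] by meson
  show ?thesis
  proof (rule exI[of _ N], intro allI impI)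
    fix V :: "'a set" and R assume V: "finite V"
    obtain F K where FK: "finite F" "finite K" "card F \<le> N" "card K \<le> N"
      and alt: "real (card (irregular_pairs V R \<epsilon> \<gamma> F K)) \<le> \<beta> * (real (card V))\<^sup>2 \<or>
          real i * c * (real (card V))\<^sup>2 \<le> energy V R F K"
      using N[OF V, of R] by blast
    have "real (card (irregular_pairs V R \<epsilon> \<gamma> F K)) \<le> \<beta> * (real (card V))\<^sup>2"
    proof (cases "V = {}")
      case True
      then show ?thesis by (simp add: irregular_pairs_def)
    next
      case False
      then have "0 < (real (card V))\<^sup>2" using V by auto
      then have "1 * (real (card V))\<^sup>2 < real i * c * (real (card V))\<^sup>2"
        using i by (intro mult_strict_right_mono) auto
      then show ?thesis using alt energy_le[OF V, of R F K] by linarith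
    qed
    then show "\<exists>F K. finite F \<and> finite K \<and> card F \<le> N \<and> card K \<le> N \<and>
       real (card (irregular_pairs V R \<epsilon> \<gamma> F K)) \<le> \<beta> * (real (card V))\<^sup>2" using FK by blast
  qed
qed

section \<open>Cleaning a relation against matchings\<close>

lemma card_in_small_atoms_le:
  assumes fin: "finite V" "finite F" and t: "0 \<le> t"
  shows "real (card {v\<in>V. real (card (atom V F v)) < t}) \<le> 2 ^ card F * t"
proof -
  let ?S = "{v\<in>V. real (card (atom V F v)) < t}"
  have finS: "finite ?S" using fin by simp
  have "real (card ?S) = (\<Sum>k\<in>trace F ` ?S. real (card {v\<in>?S. trace F v = k}))"
    using sum.image_gen[OF finS, of "\<lambda>_. 1::real" "trace F"] by simp
  also have "\<dots> \<le> (\<Sum>k\<in>trace F ` ?S. t)"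
  proof (rule sum_mono)
    fix k assume "k \<in> trace F ` ?S"
    then obtain v where v: "v \<in> ?S" "k = trace F v" by blast
    have "card {u\<in>?S. trace F u = k} \<le> card (atom V F v)"
      unfolding v(2) atom_def using fin by (intro card_mono) auto
    then show "real (card {u\<in>?S. trace F u = k}) \<le> t" using v by simp
  qed
  also have "\<dots> \<le> 2 ^ card F * t"
  proof -
    have "real (card (trace F ` ?S)) \<le> real (2 ^ card F)"
      by (intro of_nat_mono card_trace_image_le fin)
    then show ?thesis using t by (simp add: mult_right_mono)
  qed
  finally show ?thesis .
qed

text \<open>
  Elements of \<open>X\<close> are thin if \<open>X\<close> occupies only a small proportion of their atom. A large set has
  therefore mostly elements in whose atoms it is substantial, which is what allows regularity to be
  applied to the two sides of a matching.
\<close>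

lemma card_thin_part_le:
  assumes fin: "finite V" and X: "X \<subseteq> V" and \<epsilon>: "0 \<le> \<epsilon>"
  shows "real (card {v\<in>X. real (card (X \<inter> atom V F v)) < \<epsilon> * real (card (atom V F v))}) \<le> \<epsilon> * real (card V)"
proof -
  let ?S = "{v\<in>X. real (card (X \<inter> atom V F v)) < \<epsilon> * real (card (atom V F v))}"
  have SV: "?S \<subseteq> V" using X by auto
  then have finS: "finite ?S" using fin by (rule finite_subset)
  have "real (card ?S) = (\<Sum>k\<in>trace F ` ?S. real (card {v\<in>?S. trace F v = k}))"
    using sum.image_gen[OF finS, of "\<lambda>_. 1::real" "trace F"] by simp
  also have "\<dots> \<le> (\<Sum>k\<in>trace F ` ?S. \<epsilon> * real (card {v\<in>V. trace F v = k}))"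
  proof (rule sum_mono)
    fix k assume "k \<in> trace F ` ?S"
    then obtain v where v: "v \<in> ?S" "k = trace F v" by blast
    have "card {u\<in>?S. trace F u = k} \<le> card (X \<inter> atom V F v)"
      unfolding v(2) atom_def using fin X by (intro card_mono) auto
    then show "real (card {u\<in>?S. trace F u = k}) \<le> \<epsilon> * real (card {v\<in>V. trace F v = k})"
      using v by (simp add: atom_def)
  qed
  also have "\<dots> \<le> (\<Sum>k\<in>trace F ` V. \<epsilon> * real (card {v\<in>V. trace F v = k}))"
    using fin SV \<epsilon> by (intro sum_mono2) auto
  also have "\<dots> = \<epsilon> * real (card V)"
    using sum.image_gen[OF fin, of "\<lambda>_. 1::real" "trace F"] by (simp add: sum_distrib_left)
  finally show ?thesis .
qed

lemma card_low_density_le: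
  assumes fin: "finite V" and R: "R \<subseteq> V \<times> V" and t: "0 \<le> t"
  shows "real (card {p\<in>R. density V R F K p < t}) \<le> t * (real (card V))\<^sup>2"
proof -
  let ?h = "\<lambda>p. of_bool (density V R F K p < t) :: real"
  have "V \<times> V \<inter> {p. density V R F K p < t} \<inter> {p. p \<in> R} = {p\<in>R. density V R F K p < t}"
    using R by auto
  then have "real (card {p\<in>R. density V R F K p < t}) = (\<Sum>p\<in>V\<times>V. ?h p * of_bool (p \<in> R))"
    using fin by simp
  also have "\<dots> = (\<Sum>p\<in>V\<times>V. ?h p * density V R F K p)"
    unfolding density_def
    by (rule sum_mult_cond_avg[symmetric]) (use fin in \<open>auto simp: cond_avg_def\<close>)
  also have "\<dots> \<le> (\<Sum>p\<in>V\<times>V. t)"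
    using t by (intro sum_mono) auto
  finally show ?thesis by (simp add: card_cartesian_product power2_eq_square mult.commute)
qed


text \<open>
  Delete the pairs in small atoms, in cells of low density, and in irregular cells. A long matching of
  surviving pairs has a pair \<open>(v, w)\<close> whose atoms both contain a substantial part of the respective
  side of the matching, because few of its pairs have a thin end. The cell of \<open>(v, w)\<close> is regular and
  dense, so \<open>R\<close> has many pairs between these two parts.
\<close>

lemma matching_cleaning:
  assumes pos: "0 < \<delta>" "0 < \<eta>"
  shows "\<exists>\<zeta>>0. \<forall>(V :: 'a set) R. finite V \<longrightarrow> R \<subseteq> V \<times> V \<longrightarrow>
    (\<exists>R'\<subseteq>R. real (card (R - R')) \<le> \<delta> * (real (card V))\<^sup>2 \<and>
      (\<forall>M\<subseteq>R'. inj_on fst M \<longrightarrow> inj_on snd M \<longrightarrow> \<eta> * real (card V) \<le> real (card M) \<longrightarrow>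
        \<zeta> * (real (card V))\<^sup>2 \<le> real (card (R \<inter> fst ` M \<times> snd ` M))))"
proof -
  \<comment> \<open>Small atoms cost \<open>\<gamma>\<close> on either side, low density and irregularity \<open>2 * \<gamma>\<close> each: \<open>6 * \<gamma> \<le> \<delta>\<close>.
    Thin ends cost \<open>\<epsilon>\<close> on either side: \<open>2 * \<epsilon> < \<eta>\<close>.\<close>
  define \<gamma> \<epsilon> where "\<gamma> = \<delta> / 8" and "\<epsilon> = \<eta> / 4"
  have \<gamma>: "0 < \<gamma>" and \<epsilon>: "0 < \<epsilon>" using pos by (auto simp: \<gamma>_def \<epsilon>_def)
  obtain N where N: "\<And>(V :: 'a set) R. finite V \<Longrightarrow>
    \<exists>F K. finite F \<and> finite K \<and> card F \<le> N \<and> card K \<le> N \<and>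
       real (card (irregular_pairs V R \<epsilon> \<gamma> F K)) \<le> 2 * \<gamma> * (real (card V))\<^sup>2"
    using regular_families_exist[OF \<epsilon> \<gamma> mult_pos_pos[OF zero_less_numeral \<gamma>], where ?'a = 'a] by meson
  define \<tau> where "\<tau> = \<gamma> / 2 ^ N"
  have \<tau>: "0 < \<tau>" using \<gamma> by (simp add: \<tau>_def)
  define \<zeta> where "\<zeta> = \<gamma> * (\<epsilon> * \<tau>) * (\<epsilon> * \<tau>)"
  have \<zeta>: "0 < \<zeta>" using \<gamma> \<epsilon> \<tau> by (simp add: \<zeta>_def)
  have clean: "\<exists>R'\<subseteq>R. real (card (R - R')) \<le> \<delta> * (real (card V))\<^sup>2 \<and>
      (\<forall>M\<subseteq>R'. inj_on fst M \<longrightarrow> inj_on snd M \<longrightarrow> \<eta> * real (card V) \<le> real (card M) \<longrightarrow>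
        \<zeta> * (real (card V))\<^sup>2 \<le> real (card (R \<inter> fst ` M \<times> snd ` M)))"
    if V: "finite V" and R: "R \<subseteq> V \<times> V" for V :: "'a set" and R
  proof -
    define n where "n = real (card V)"
    obtain F K where FK: "finite F" "finite K" "card F \<le> N" "card K \<le> N"
      and irr: "real (card (irregular_pairs V R \<epsilon> \<gamma> F K)) \<le> 2 * \<gamma> * n\<^sup>2"
      using N[OF V, of R] unfolding n_def by blast
    define small where "small G = {v\<in>V. real (card (atom V G v)) < \<tau> * n}" for G
    have n0: "0 \<le> n" by (simp add: n_def)
    have small: "real (card (small G)) \<le> \<gamma> * n" if "finite G" "card G \<le> N" for G
    proof -
      have "real (card (small G)) \<le> 2 ^ card G * (\<tau> * n)"
        unfolding small_def using card_in_small_atoms_le[OF V that(1)] \<tau> n0 by simp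
      also have "\<dots> \<le> 2 ^ N * (\<tau> * n)"
        using that(2) \<tau> n0 by (intro mult_right_mono power_increasing) auto
      finally show ?thesis by (simp add: \<tau>_def)
    qed
    define low where "low = {p\<in>R. density V R F K p < 2 * \<gamma>}"
    define R' where "R' = R - (small F \<times> V \<union> V \<times> small K \<union> low \<union> irregular_pairs V R \<epsilon> \<gamma> F K)"
    have finR: "finite R" using R V finite_subset by blast
    have fins: "finite (small F)" "finite (small K)" "finite low" "finite (irregular_pairs V R \<epsilon> \<gamma> F K)"
      using V finR by (auto simp: small_def low_def irregular_pairs_def)
    have "card (R - R') \<le> card (small F \<times> V \<union> V \<times> small K \<union> low \<union> irregular_pairs V R \<epsilon> \<gamma> F K)"
      using fins V by (intro card_mono) (auto simp: R'_def)
    also have "\<dots> \<le> card (small F \<times> V) + card (V \<times> small K) + card low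
        + card (irregular_pairs V R \<epsilon> \<gamma> F K)"
      by (intro order_trans[OF card_Un_le] add_mono order_refl)
    finally have "real (card (R - R')) \<le> real (card (small F)) * n + n * real (card (small K))
        + real (card low) + real (card (irregular_pairs V R \<epsilon> \<gamma> F K))"
      unfolding n_def card_cartesian_product by (metis of_nat_add of_nat_mono of_nat_mult)
    also have "\<dots> \<le> \<gamma> * n * n + n * (\<gamma> * n) + 2 * \<gamma> * n\<^sup>2 + 2 * \<gamma> * n\<^sup>2"
      unfolding low_def n_def
      by (intro add_mono mult_mono small[unfolded n_def] card_low_density_le irr[unfolded n_def])
        (use FK V R \<gamma> in auto)
    also have "\<dots> \<le> \<delta> * n\<^sup>2" using \<gamma> by (simp add: \<gamma>_def power2_eq_square)
    finally have removed: "real (card (R - R')) \<le> \<delta> * n\<^sup>2" .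
    have spanned: "\<zeta> * n\<^sup>2 \<le> real (card (R \<inter> fst ` M \<times> snd ` M))"
      if M: "M \<subseteq> R'" "inj_on fst M" "inj_on snd M" "\<eta> * n \<le> real (card M)" for M
    proof (cases "n = 0")
      case True
      then show ?thesis by simp
    next
      case False
      then have npos: "0 < n" using n0 by simp
      have MV: "M \<subseteq> V \<times> V" using M(1) R by (auto simp: R'_def)
      define X Y where "X = fst ` M" and "Y = snd ` M"
      have XY: "X \<subseteq> V" "Y \<subseteq> V" using MV by (auto simp: X_def Y_def)
      define thin where "thin Z G = {v\<in>Z. real (card (Z \<inter> atom V G v)) < \<epsilon> * real (card (atom V G v))}" for Z G
      have thin: "real (card (thin Z G)) \<le> \<epsilon> * n" "finite (thin Z G)" if "Z \<subseteq> V" for Z G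
        using card_thin_part_le[OF V that, of \<epsilon> G] \<epsilon> finite_subset[OF that V] by (auto simp: thin_def n_def)
      have "card {p\<in>M. fst p \<in> thin X F} \<le> card (thin X F)"
        by (rule card_inj_on_le[where f=fst]) (use M(2) thin XY in \<open>auto intro: inj_on_subset\<close>)
      moreover have "card {p\<in>M. snd p \<in> thin Y K} \<le> card (thin Y K)"
        by (rule card_inj_on_le[where f=snd]) (use M(3) thin XY in \<open>auto intro: inj_on_subset\<close>)
      moreover have "card ({p\<in>M. fst p \<in> thin X F} \<union> {p\<in>M. snd p \<in> thin Y K})
          \<le> card {p\<in>M. fst p \<in> thin X F} + card {p\<in>M. snd p \<in> thin Y K}"
        by (rule card_Un_le)
      ultimately have "real (card ({p\<in>M. fst p \<in> thin X F} \<union> {p\<in>M. snd p \<in> thin Y K})) \<le> \<epsilon> * n + \<epsilon> * n"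
        using thin(1)[OF XY(1), of F] thin(1)[OF XY(2), of K] by linarith
      also have "\<dots> < \<eta> * n" using npos pos by (simp add: \<epsilon>_def)
      also have "\<dots> \<le> real (card M)" by (rule M)
      finally have "{p\<in>M. fst p \<in> thin X F} \<union> {p\<in>M. snd p \<in> thin Y K} \<noteq> M" by auto
      then obtain v w where p: "(v, w) \<in> M" "v \<notin> thin X F" "w \<notin> thin Y K" by fastforce
      have pR': "(v, w) \<in> R'" and vw: "v \<in> V" "w \<in> V" using p M(1) MV by auto
      define P Q where "P = atom V F v" and "Q = atom V K w"
      have fat: "\<epsilon> * real (card P) \<le> real (card (X \<inter> P))" "\<epsilon> * real (card Q) \<le> real (card (Y \<inter> Q))"
        using p by (force simp: thin_def P_def Q_def X_def Y_def)+
      have big: "\<tau> * n \<le> real (card P)" "\<tau> * n \<le> real (card Q)"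
        using pR' vw by (auto simp: R'_def small_def P_def Q_def)
      have dens: "2 * \<gamma> \<le> density V R F K (v, w)"
        using pR' by (auto simp: R'_def low_def)
      have "\<not> deficient V R \<epsilon> \<gamma> F K (v, w) (X \<inter> P, Y \<inter> Q)"
        using pR' vw by (auto simp: R'_def irregular_pairs_def)
      then have cnt: "(density V R F K (v, w) - \<gamma>) * real (card (X \<inter> P)) * real (card (Y \<inter> Q))
          \<le> real (card (R \<inter> (X \<inter> P) \<times> (Y \<inter> Q)))"
        using fat by (auto simp: deficient_def P_def Q_def)
      have *: "\<epsilon> * (\<tau> * n) \<le> real (card (X \<inter> P))" "\<epsilon> * (\<tau> * n) \<le> real (card (Y \<inter> Q))"
        using fat mult_left_mono[OF big(1), of \<epsilon>] mult_left_mono[OF big(2), of \<epsilon>] \<epsilon> by linarith+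
      have "\<zeta> * n\<^sup>2 = \<gamma> * (\<epsilon> * (\<tau> * n)) * (\<epsilon> * (\<tau> * n))"
        by (simp add: \<zeta>_def power2_eq_square)
      also have "\<dots> \<le> (density V R F K (v, w) - \<gamma>) * real (card (X \<inter> P)) * real (card (Y \<inter> Q))"
        using * dens \<gamma> \<epsilon> \<tau> npos by (intro mult_mono) auto
      also note cnt
      also have "real (card (R \<inter> (X \<inter> P) \<times> (Y \<inter> Q))) \<le> real (card (R \<inter> X \<times> Y))"
        using finR by (intro of_nat_mono card_mono) auto
      finally show ?thesis by (simp add: X_def Y_def)
    qed
    moreover have "R' \<subseteq> R" by (auto simp: R'_def)
    ultimately show ?thesis
      using removed unfolding n_def by (intro exI[of _ R'] conjI allI impI)
  qed
  show ?thesis by (intro exI[of _ \<zeta>] conjI \<zeta> allI impI clean)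
qed

section \<open>Wickets in linear hypergraphs\<close>

lemma linear_3_graph_edgeD:
  assumes "linear_3_graph H" "{a, b, c} \<in> edges H"
  shows "a \<noteq> b" "a \<noteq> c" "b \<noteq> c" "a \<in> verts H" "b \<in> verts H" "c \<in> verts H"
proof -
  have "card {a, b, c} = 3" "{a, b, c} \<subseteq> verts H"
    using assms by (auto simp: linear_3_graph_def three_uniform_def finite_hypergraph_def)
  then show "a \<noteq> b" "a \<noteq> c" "b \<noteq> c" "a \<in> verts H" "b \<in> verts H" "c \<in> verts H"
    by (auto simp: card_insert_if split: if_splits)
qed

lemma linear_3_graph_third_unique:
  assumes H: "linear_3_graph H" and e: "{a, b, c} \<in> edges H" "{a, b, d} \<in> edges H"
  shows "c = d"
proof -
  note D = linear_3_graph_edgeD[OF H]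
  have "{a, b, c} = {a, b, d}"
  proof (rule ccontr)
    assume "{a, b, c} \<noteq> {a, b, d}"
    then have "card ({a, b, c} \<inter> {a, b, d}) \<le> 1"
      using H e unfolding linear_3_graph_def linear_hypergraph_def by metis
    moreover have "card {a, b} \<le> card ({a, b, c} \<inter> {a, b, d})" by (intro card_mono) auto
    ultimately show False using D[OF e(1)] by simp
  qed
  then show ?thesis using D[OF e(1)] D[OF e(2)] by auto
qed

lemma contains_wicketI:
  assumes H: "finite_hypergraph H"
    and dist: "distinct [a11, a12, a13, a21, a22, a23, a31, a32, a33]"
    and rows: "{a11, a12, a13} \<in> edges H" "{a21, a22, a23} \<in> edges H" "{a31, a32, a33} \<in> edges H"
    and cols: "{a11, a21, a31} \<in> edges H" "{a12, a22, a32} \<in> edges H"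
  shows "contains_copy H wicket"
proof -
  define f :: "nat \<times> nat \<Rightarrow> 'a" where "f = (\<lambda>(i, j).
    if i = 1 then (if j = 1 then a11 else if j = 2 then a12 else a13)
    else if i = 2 then (if j = 1 then a21 else if j = 2 then a22 else a23)
    else (if j = 1 then a31 else if j = 2 then a32 else a33))"
  have f: "f (1, 1) = a11" "f (1, 2) = a12" "f (1, 3) = a13" "f (2, 1) = a21" "f (2, 2) = a22"
    "f (2, 3) = a23" "f (3, 1) = a31" "f (3, 2) = a32" "f (3, 3) = a33"
    by (simp_all add: f_def)
  have ranges: "{1..3::nat} = {1, 2, 3}" "{1..2::nat} = {1, 2}" by auto
  have grid: "verts wicket = {(1, 1), (1, 2), (1, 3), (2, 1), (2, 2), (2, 3), (3, 1), (3, 2), (3, 3)}"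
    unfolding wicket_def ranges by auto
  have lines: "edges wicket = {{(1, 1), (1, 2), (1, 3)}, {(2, 1), (2, 2), (2, 3)}, {(3, 1), (3, 2), (3, 3)},
      {(1, 1), (2, 1), (3, 1)}, {(1, 2), (2, 2), (3, 2)}}"
    unfolding wicket_def ranges by auto
  let ?W = "\<lparr>verts = f ` verts wicket, edges = (`) f ` edges wicket\<rparr>"
  have E: "edges ?W = {{a11, a12, a13}, {a21, a22, a23}, {a31, a32, a33}, {a11, a21, a31}, {a12, a22, a32}}"
    by (simp only: lines image_insert image_empty f hypergraph.simps)
  have V: "verts ?W = {a11, a12, a13, a21, a22, a23, a31, a32, a33}"
    by (simp only: grid image_insert image_empty f hypergraph.simps)
  have "card (f ` verts wicket) = 9"
    using dist unfolding grid image_insert image_empty f by simp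
  moreover have "card (verts wicket) = 9" by (rule wicket_size)
  ultimately have inj: "inj_on f (verts wicket)"
    by (intro eq_card_imp_inj_on) (simp_all add: wicket_def)
  have "subhypergraph ?W H"
    unfolding subhypergraph_def finite_hypergraph_def E V
    using H rows cols by (auto simp: finite_hypergraph_def)
  moreover have "isomorphic wicket ?W"
    unfolding isomorphic_def using inj by (intro exI[of _ f]) (auto simp: bij_betw_def)
  ultimately show ?thesis unfolding contains_copy_def by blast
qed

text \<open>
  The pairs in \<open>Q\<close> are candidates for the first two points of the first row; the rest of the wicket
  exists by assumption, up to coincidences among its nine points. By linearity each of these is
  impossible or implies one of eight. In each of the eight, one component of the pair
  determines the other, so it occurs for at most \<open>card (verts H)\<close> pairs.
\<close>

lemma contains_wicket_if_many_row_pairs: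
  assumes H: "linear_3_graph H" and xy: "x \<noteq> y" and Q: "Q \<subseteq> verts H \<times> verts H"
    and up: "\<And>a b. (a, b) \<in> Q \<Longrightarrow> \<exists>b' a'. {a, b', x} \<in> edges H \<and> {a', b', y} \<in> edges H"
    and down: "\<And>a b. (a, b) \<in> Q \<Longrightarrow> \<exists>a' b'. {a', b, y} \<in> edges H \<and> {a', b', x} \<in> edges H"
    and row: "\<And>a b. (a, b) \<in> Q \<Longrightarrow> \<exists>c. {a, b, c} \<in> edges H"
    and many: "8 * card (verts H) < card Q"
  shows "contains_copy H wicket"
proof (rule ccontr)
  assume free: "\<not> contains_copy H wicket"
  define T where "T a b c \<longleftrightarrow> {a, b, c} \<in> edges H" for a b c
  have perm: "T b a c" "T c b a" "T a c b" if "T a b c" for a b c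
    using that by (simp_all add: T_def insert_commute)
  have uniq: "c = d" if "T a b c" "T a b d" for a b c d
    using that linear_3_graph_third_unique[OF H] by (simp add: T_def)
  have uniq1: "c = d" if "T c a b" "T d a b" for a b c d
    by (metis that perm uniq)
  have uniq2: "c = d" if "T a c b" "T a d b" for a b c d
    by (metis that perm uniq)
  have neq: "a \<noteq> b" "a \<noteq> c" "b \<noteq> c" if "T a b c" for a b c
    using linear_3_graph_edgeD[OF H] that by (auto simp: T_def)
  \<comment> \<open>With \<open>p = (a, b)\<close>, the wicket to be found has the rows \<open>(a, b, c3)\<close>, \<open>(b1, y, a3)\<close>, \<open>(x, a2, b3)\<close>.\<close>
  have "\<forall>p\<in>Q. \<exists>b1 a3 a2 b3 c3. T (fst p) b1 x \<and> T a3 b1 y \<and> T a2 (snd p) y \<and> T a2 b3 x \<and>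
    T (fst p) (snd p) c3"
  proof
    fix p assume "p \<in> Q"
    then have "(fst p, snd p) \<in> Q" by simp
    from up[OF this] down[OF this] row[OF this]
    show "\<exists>b1 a3 a2 b3 c3. T (fst p) b1 x \<and> T a3 b1 y \<and> T a2 (snd p) y \<and> T a2 b3 x \<and>
      T (fst p) (snd p) c3" unfolding T_def by blast
  qed
  then obtain b1 a3 a2 b3 c3 where
    col1: "\<And>p. p \<in> Q \<Longrightarrow> T (fst p) (b1 p) x" and row2: "\<And>p. p \<in> Q \<Longrightarrow> T (a3 p) (b1 p) y" and
    col2: "\<And>p. p \<in> Q \<Longrightarrow> T (a2 p) (snd p) y" and row3: "\<And>p. p \<in> Q \<Longrightarrow> T (a2 p) (b3 p) x" and
    row1: "\<And>p. p \<in> Q \<Longrightarrow> T (fst p) (snd p) (c3 p)"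
    unfolding bchoice_iff by metis
  define n where "n = card (verts H)"
  have finV: "finite (verts H)" using H by (simp add: linear_3_graph_def finite_hypergraph_def)
  then have finQ: "finite Q" using Q finite_subset by blast
  have b1: "b1 p = b1 q" if "p \<in> Q" "q \<in> Q" "fst p = fst q" for p q
    using col1[OF that(1)] col1[OF that(2)] that(3) uniq2 by metis
  have a3: "a3 p = a3 q" if "p \<in> Q" "q \<in> Q" "fst p = fst q" for p q
    using row2[OF that(1)] row2[OF that(2)] b1[OF that] uniq1 by metis
  have a2: "a2 p = a2 q" if "p \<in> Q" "q \<in> Q" "snd p = snd q" for p q
    using col2[OF that(1)] col2[OF that(2)] that(3) uniq1 by metis
  have b3: "b3 p = b3 q" if "p \<in> Q" "q \<in> Q" "snd p = snd q" for p q
    using row3[OF that(1)] row3[OF that(2)] a2[OF that] uniq2 by metis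
  have few_fst: "card {p\<in>Q. C p} \<le> n"
    if "\<And>p q. p \<in> Q \<Longrightarrow> q \<in> Q \<Longrightarrow> C p \<Longrightarrow> C q \<Longrightarrow> fst p = fst q \<Longrightarrow> snd p = snd q" for C
    unfolding n_def
    by (rule card_inj_on_le[where f=fst]) (use that Q finV in \<open>auto simp: inj_on_def prod_eq_iff\<close>)
  have few_snd: "card {p\<in>Q. C p} \<le> n"
    if "\<And>p q. p \<in> Q \<Longrightarrow> q \<in> Q \<Longrightarrow> C p \<Longrightarrow> C q \<Longrightarrow> snd p = snd q \<Longrightarrow> fst p = fst q" for C
    unfolding n_def
    by (rule card_inj_on_le[where f=snd]) (use that Q finV in \<open>auto simp: inj_on_def prod_eq_iff\<close>)
  have bad: "card {p\<in>Q. fst p = a2 p} \<le> n" "card {p\<in>Q. fst p = y} \<le> n" "card {p\<in>Q. snd p = x} \<le> n"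
    "card {p\<in>Q. b1 p = a2 p} \<le> n" "card {p\<in>Q. b1 p = snd p} \<le> n"
    "card {p\<in>Q. c3 p = a3 p} \<le> n" "card {p\<in>Q. c3 p = b3 p} \<le> n" "card {p\<in>Q. a3 p = b3 p} \<le> n"
  proof -
    show "card {p\<in>Q. fst p = a2 p} \<le> n" by (rule few_snd) (metis a2)
    show "card {p\<in>Q. fst p = y} \<le> n" by (rule few_snd) metis
    show "card {p\<in>Q. snd p = x} \<le> n" by (rule few_fst) metis
    show "card {p\<in>Q. b1 p = a2 p} \<le> n" by (rule few_snd) (metis a2 col1 uniq1)
    show "card {p\<in>Q. b1 p = snd p} \<le> n" by (rule few_snd) (metis col1 uniq1)
    show "card {p\<in>Q. c3 p = a3 p} \<le> n" by (rule few_fst) (metis a3 row1 uniq2)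
    show "card {p\<in>Q. c3 p = b3 p} \<le> n" by (rule few_snd) (metis b3 row1 uniq1)
    show "card {p\<in>Q. a3 p = b3 p} \<le> n" by (rule few_fst) (metis a3 row3 col2 uniq1 uniq2)
  qed
  have good: False
    if p: "p \<in> Q" and ok: "fst p \<noteq> a2 p" "fst p \<noteq> y" "snd p \<noteq> x" "b1 p \<noteq> a2 p" "b1 p \<noteq> snd p"
      "c3 p \<noteq> a3 p" "c3 p \<noteq> b3 p" "a3 p \<noteq> b3 p" for p
  proof -
    note e = col1[OF p] col2[OF p] row1[OF p] row2[OF p] row3[OF p]
    have c: "c3 p \<noteq> b1 p" "c3 p \<noteq> x" "c3 p \<noteq> y" "c3 p \<noteq> a2 p"
      using e ok xy perm uniq by metis+
    have a: "a3 p \<noteq> fst p" "a3 p \<noteq> x" "a3 p \<noteq> snd p" "a3 p \<noteq> a2 p"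
      using e ok xy perm uniq by metis+
    have b: "b3 p \<noteq> fst p" "b3 p \<noteq> b1 p" "b3 p \<noteq> snd p" "b3 p \<noteq> y"
      using e ok xy perm uniq by metis+
    have "distinct [fst p, snd p, c3 p, b1 p, y, a3 p, x, a2 p, b3 p]"
      using neq[OF e(1)] neq[OF e(2)] neq[OF e(3)] neq[OF e(4)] neq[OF e(5)] a b c ok xy by auto
    then have "contains_copy H wicket"
      by (rule contains_wicketI[rotated])
        (use H perm e in \<open>auto simp: T_def linear_3_graph_def insert_commute\<close>)
    then show False using free by blast
  qed
  have "Q \<subseteq> {p\<in>Q. fst p = a2 p} \<union> {p\<in>Q. fst p = y} \<union> {p\<in>Q. snd p = x} \<union> {p\<in>Q. b1 p = a2 p} \<union>
     {p\<in>Q. b1 p = snd p} \<union> {p\<in>Q. c3 p = a3 p} \<union> {p\<in>Q. c3 p = b3 p} \<union> {p\<in>Q. a3 p = b3 p}" (is "_ \<subseteq> ?U")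
    using good by blast
  then have "card Q \<le> card ?U" using finQ by (intro card_mono) auto
  also have "\<dots> \<le> n + n + n + n + n + n + n + n"
    by (intro order_trans[OF card_Un_le] add_mono bad)
  finally show False using many by (simp add: n_def)
qed

text \<open>
  The first deletion must leave enough for a second one, and the second one must leave a long matching
  of some colour. The relation \<open>R\<close> consists of the shadow pairs, and \<open>R2 \<subseteq> R1 \<subseteq> R\<close> are the results of the two deletions. The set \<open>M x\<close> is the matching of colour \<open>x\<close>
  in \<open>R2\<close>, \<open>Pc y\<close> consists of the pairs of colour \<open>y\<close> in \<open>R1\<close> spanned by it, and \<open>M'\<close> of the pairs of
  \<open>M x\<close> that continue to a pair in \<open>Pc y\<close>.
\<close>

lemma dense_linear_3_graph_contains_wicket:
  assumes c: "0 < c"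
  shows "\<exists>n0. \<forall>H :: 'a hypergraph. linear_3_graph H \<longrightarrow> n0 \<le> card (verts H) \<longrightarrow>
    c * (real (card (verts H)))\<^sup>2 \<le> real (card (edges H)) \<longrightarrow> contains_copy H wicket"
proof -
  obtain \<zeta>1 where \<zeta>1: "0 < \<zeta>1" and clean1: "\<And>(V :: 'a set) R. finite V \<Longrightarrow> R \<subseteq> V \<times> V \<Longrightarrow>
    \<exists>R'\<subseteq>R. real (card (R - R')) \<le> c / 4 * (real (card V))\<^sup>2 \<and>
      (\<forall>M\<subseteq>R'. inj_on fst M \<longrightarrow> inj_on snd M \<longrightarrow> c / 4 * real (card V) \<le> real (card M) \<longrightarrow>
        \<zeta>1 * (real (card V))\<^sup>2 \<le> real (card (R \<inter> fst ` M \<times> snd ` M)))"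
    using matching_cleaning[of "c / 4" "c / 4", where ?'a = 'a] c by auto
  obtain \<zeta>2 where \<zeta>2: "0 < \<zeta>2" and clean2: "\<And>(V :: 'a set) R. finite V \<Longrightarrow> R \<subseteq> V \<times> V \<Longrightarrow>
    \<exists>R'\<subseteq>R. real (card (R - R')) \<le> c / 2 * (real (card V))\<^sup>2 \<and>
      (\<forall>M\<subseteq>R'. inj_on fst M \<longrightarrow> inj_on snd M \<longrightarrow> \<zeta>1 / 2 * real (card V) \<le> real (card M) \<longrightarrow>
        \<zeta>2 * (real (card V))\<^sup>2 \<le> real (card (R \<inter> fst ` M \<times> snd ` M)))"
    using matching_cleaning[of "c / 2" "\<zeta>1 / 2", where ?'a = 'a] c \<zeta>1 by auto
  obtain n0 :: nat where n0: "2 / \<zeta>1 + 8 / \<zeta>2 + 1 < real n0" using reals_Archimedean2 by blast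
  show ?thesis
  proof (rule exI[of _ n0], intro allI impI)
    fix H :: "'a hypergraph"
    assume H: "linear_3_graph H" and "n0 \<le> card (verts H)"
      and dense: "c * (real (card (verts H)))\<^sup>2 \<le> real (card (edges H))"
    define V n where "V = verts H" and "n = real (card V)"
    define T where "T a b z \<longleftrightarrow> {a, b, z} \<in> edges H" for a b z
    have "2 / \<zeta>1 + 8 / \<zeta>2 + 1 < n" using n0 \<open>n0 \<le> card (verts H)\<close> by (simp add: n_def V_def)
    moreover have "0 < 2 / \<zeta>1" "0 < 8 / \<zeta>2" using \<zeta>1 \<zeta>2 by auto
    ultimately have "1 < n" "2 / \<zeta>1 \<le> n" "8 / \<zeta>2 < n" by linarith+
    then have n: "1 < n" "2 \<le> \<zeta>1 * n" "8 < \<zeta>2 * n" using \<zeta>1 \<zeta>2 by (auto simp: field_simps)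
    have finV: "finite V" using H by (simp add: V_def linear_3_graph_def finite_hypergraph_def)
    have V: "V \<noteq> {}" using n by (auto simp: n_def)
    note edgeD = linear_3_graph_edgeD[OF H, folded T_def V_def]
    have perm: "T b a z" "T z b a" "T a z b" if "T a b z" for a b z
      using that by (simp_all add: T_def insert_commute)
    have uniq: "z = w" if "T a b z" "T a b w" for a b z w
      using that linear_3_graph_third_unique[OF H] by (simp add: T_def)
    have uniq1: "z = w" if "T z a b" "T w a b" for a b z w by (metis that perm uniq)
    have uniq2: "z = w" if "T a z b" "T a w b" for a b z w by (metis that perm uniq)

    define R where "R = {p. \<exists>z. T (fst p) (snd p) z}"
    have RV: "R \<subseteq> V \<times> V" using edgeD by (auto simp: R_def)
    have third: "\<exists>z\<in>V. T (fst p) (snd p) z" if "p \<in> R" for p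
      using that edgeD(6) by (auto simp: R_def)
    have finR: "finite R" using RV finV finite_subset by blast
    \<comment> \<open>Every edge can be recovered from one of its shadow pairs.\<close>
    have "edges H \<subseteq> (\<lambda>(a, b). {a, b, THE z. T a b z}) ` R"
    proof
      fix e assume e: "e \<in> edges H"
      then have "card e = 3" using H by (simp add: linear_3_graph_def three_uniform_def)
      then obtain a b z where abz: "e = {a, b, z}" unfolding card_3_iff by blast
      then have T: "T a b z" using e by (simp add: T_def)
      then have "(THE z. T a b z) = z" using uniq by blast
      then show "e \<in> (\<lambda>(a, b). {a, b, THE z. T a b z}) ` R"
        using T abz by (intro image_eqI[of _ _ "(a, b)"]) (auto simp: R_def)
    qed
    then have "card (edges H) \<le> card R" using finR by (meson surj_card_le)
    then have cR: "c * n\<^sup>2 \<le> real (card R)" using dense by (simp add: n_def V_def)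

    obtain R1 where R1: "R1 \<subseteq> R" "real (card (R - R1)) \<le> c / 2 * n\<^sup>2"
      and match1: "\<And>M. M \<subseteq> R1 \<Longrightarrow> inj_on fst M \<Longrightarrow> inj_on snd M \<Longrightarrow> \<zeta>1 / 2 * n \<le> real (card M) \<Longrightarrow>
        \<zeta>2 * n\<^sup>2 \<le> real (card (R \<inter> fst ` M \<times> snd ` M))"
      using clean2[OF finV RV] unfolding n_def by blast
    have R1V: "R1 \<subseteq> V \<times> V" using R1 RV by blast
    obtain R2 where R2: "R2 \<subseteq> R1" "real (card (R1 - R2)) \<le> c / 4 * n\<^sup>2"
      and match2: "\<And>M. M \<subseteq> R2 \<Longrightarrow> inj_on fst M \<Longrightarrow> inj_on snd M \<Longrightarrow> c / 4 * n \<le> real (card M) \<Longrightarrow>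
        \<zeta>1 * n\<^sup>2 \<le> real (card (R1 \<inter> fst ` M \<times> snd ` M))"
      using clean1[OF finV R1V] unfolding n_def by blast
    have fin1: "finite R1" using R1(1) finR by (rule finite_subset)
    have fin2: "finite R2" using R2(1) fin1 by (rule finite_subset)
    have "card R = card R1 + card (R - R1)" "card R1 = card R2 + card (R1 - R2)"
      using card_Diff_subset[OF fin1 R1(1)] card_mono[OF finR R1(1)]
        card_Diff_subset[OF fin2 R2(1)] card_mono[OF fin1 R2(1)] by linarith+
    then have cR2: "c / 4 * n\<^sup>2 \<le> real (card R2)" using cR R1(2) R2(2) by simp
    have match: "inj_on fst M \<and> inj_on snd M" if "\<And>p. p \<in> M \<Longrightarrow> T (fst p) (snd p) z" for M z
    proof (intro conjI inj_onI)
      fix p q assume pq: "p \<in> M" "q \<in> M"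
      note T = that[OF pq(1)] that[OF pq(2)]
      show "p = q" if "fst p = fst q" using T uniq2 that by (metis prod.expand)
      show "p = q" if "snd p = snd q" using T uniq1 that by (metis prod.expand)
    qed

    define M where "M z = {p\<in>R2. T (fst p) (snd p) z}" for z
    have "\<exists>x\<in>V. c / 4 * n \<le> real (card (M x))"
    proof (rule ccontr)
      assume "\<not> ?thesis"
      then have less: "real (card (M z)) < c / 4 * n" if "z \<in> V" for z using that by force
      have "R2 = (\<Union>z\<in>V. M z)" using R1(1) R2(1) third unfolding M_def by blast
      then have "card R2 \<le> (\<Sum>z\<in>V. card (M z))" using card_UN_le[OF finV, of M] by simp
      then have "real (card R2) \<le> (\<Sum>z\<in>V. real (card (M z)))" by (metis of_nat_mono of_nat_sum)
      also have "\<dots> < (\<Sum>z\<in>V. c / 4 * n)" by (rule sum_strict_mono) (use finV V less in auto)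
      also have "\<dots> = c / 4 * n\<^sup>2" by (simp add: n_def power2_eq_square)
      finally show False using cR2 by simp
    qed
    then obtain x where x: "x \<in> V" "c / 4 * n \<le> real (card (M x))" by blast
    have Mx: "inj_on fst (M x)" "inj_on snd (M x)" "M x \<subseteq> R2" using match[of "M x" x] by (auto simp: M_def)
    define P where "P = R1 \<inter> fst ` M x \<times> snd ` M x"
    have cP: "\<zeta>1 * n\<^sup>2 \<le> real (card P)" unfolding P_def by (rule match2) (use Mx x in auto)
    define Pc where "Pc z = {p\<in>P. T (fst p) (snd p) z}" for z
    have Pc: "inj_on fst (Pc z)" "inj_on snd (Pc z)" for z using match[of "Pc z" z] by (auto simp: Pc_def)
    \<comment> \<open>The pairs of colour \<open>x\<close> itself have to be discarded, but there are at most \<open>n\<close> of them.\<close>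
    have "\<exists>y\<in>V. y \<noteq> x \<and> \<zeta>1 / 2 * n \<le> real (card (Pc y))"
    proof (rule ccontr)
      assume "\<not> ?thesis"
      then have le: "real (card (Pc z)) \<le> \<zeta>1 / 2 * n" if "z \<in> V - {x}" for z using that by force
      have "card (Pc x) \<le> card V"
        by (rule card_inj_on_le[OF Pc(1)]) (use R1V finV in \<open>auto simp: Pc_def P_def\<close>)
      then have Px: "real (card (Pc x)) \<le> n" by (simp add: n_def)
      have "P = (\<Union>z\<in>V. Pc z)" using R1(1) third unfolding Pc_def P_def by blast
      then have "card P \<le> (\<Sum>z\<in>V. card (Pc z))" using card_UN_le[OF finV, of Pc] by simp
      then have "real (card P) \<le> (\<Sum>z\<in>V. real (card (Pc z)))" by (metis of_nat_mono of_nat_sum)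
      also have "\<dots> = real (card (Pc x)) + (\<Sum>z\<in>V - {x}. real (card (Pc z)))"
        by (rule sum.remove[OF finV x(1)])
      also have "\<dots> \<le> n + (\<Sum>z\<in>V - {x}. \<zeta>1 / 2 * n)"
        by (intro add_mono Px sum_mono le)
      also have "\<dots> = n + (n - 1) * (\<zeta>1 / 2 * n)"
        using x(1) finV V by (simp add: n_def of_nat_diff Suc_leI card_gt_0_iff)
      also have "\<dots> < n + n * (\<zeta>1 / 2 * n)" using n \<zeta>1 by simp
      also have "\<dots> \<le> (\<zeta>1 * n) / 2 * n + n * (\<zeta>1 / 2 * n)"
        by (rule add_right_mono) (use n mult_right_mono[of 1 "\<zeta>1 * n / 2" n] in simp)
      also have "\<dots> = \<zeta>1 * n\<^sup>2" by (simp add: power2_eq_square)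
      finally show False using cP by simp
    qed
    then obtain y where y: "y \<in> V" "x \<noteq> y" "\<zeta>1 / 2 * n \<le> real (card (Pc y))" by blast
    define M' where "M' = {p\<in>M x. snd p \<in> snd ` Pc y}"
    have "snd ` M' = snd ` Pc y" by (force simp: M'_def Pc_def P_def)
    then have "card (Pc y) = card (snd ` M')" using card_image[OF Pc(2)] by simp
    also have "\<dots> \<le> card M'" using fin2 by (intro card_image_le) (simp add: M'_def M_def)
    finally have cM': "\<zeta>1 / 2 * n \<le> real (card M')" using y by simp
    define Q where "Q = R \<inter> fst ` M' \<times> snd ` M'"
    have "\<zeta>2 * n\<^sup>2 \<le> real (card Q)" unfolding Q_def
    proof (rule match1)
      show "M' \<subseteq> R1" using R2 by (auto simp: M'_def M_def)
      show "inj_on fst M'" "inj_on snd M'" using Mx by (auto simp: M'_def intro: inj_on_subset)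
    qed (rule cM')
    moreover have "8 * n < \<zeta>2 * n\<^sup>2"
      using n mult_strict_right_mono[of 8 "\<zeta>2 * n" n] by (simp add: power2_eq_square)
    ultimately have "8 * card (verts H) < card Q" by (simp add: n_def V_def)
    show "contains_copy H wicket"
    proof (rule contains_wicket_if_many_row_pairs[OF H y(2), of Q])
      show "Q \<subseteq> verts H \<times> verts H" using RV by (auto simp: Q_def V_def)
      show "8 * card (verts H) < card Q" by fact
      fix a b assume ab: "(a, b) \<in> Q"
      then obtain b' where "(a, b') \<in> M'" by (auto simp: Q_def)
      then show "\<exists>b' a'. {a, b', x} \<in> edges H \<and> {a', b', y} \<in> edges H"
        by (fastforce simp: M'_def M_def Pc_def T_def)
      obtain a' where a': "(a', b) \<in> Pc y" using ab by (force simp: Q_def M'_def)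
      then have "a' \<in> fst ` M x" by (auto simp: Pc_def P_def)
      then obtain b' where "(a', b') \<in> M x" by auto
      then show "\<exists>a' b'. {a', b, y} \<in> edges H \<and> {a', b', x} \<in> edges H"
        using a' by (auto simp: M_def Pc_def T_def)
      show "\<exists>c. {a, b, c} \<in> edges H" using ab by (auto simp: Q_def R_def T_def)
    qed
  qed
qed

theorem theorem2p1:
  shows "(\<lambda>n. real (ex_L n wicket)) \<in> o(\<lambda>n. (real n)\<^sup>2) \<and>
    (\<forall>c::real. c > 0 \<longrightarrow> (\<exists>n0::nat. \<forall>n\<ge>n0. \<forall>H :: 'a hypergraph.
       linear_3_graph H \<and> card (verts H) = n \<and> \<not> contains_copy H wicket
         \<longrightarrow> real (card (edges H)) < c * (real n)\<^sup>2))"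
proof (intro conjI landau_o.smallI allI impI)
  fix c :: real assume c: "c > 0"
  obtain n0 where n0: "\<And>H :: nat hypergraph. linear_3_graph H \<Longrightarrow> n0 \<le> card (verts H) \<Longrightarrow>
    c * (real (card (verts H)))\<^sup>2 \<le> real (card (edges H)) \<Longrightarrow> contains_copy H wicket"
    using dense_linear_3_graph_contains_wicket[OF c] by blast
  show "\<forall>\<^sub>F n in sequentially. norm (real (ex_L n wicket)) \<le> c * norm ((real n)\<^sup>2)"
  proof (rule eventually_sequentiallyI)
    fix n assume n: "n0 \<le> n"
    have "edges wicket \<noteq> {}" by (simp add: wicket_def)
    from Max_in[OF finite_ex_L_set ex_L_set_nonempty[OF this]]
    obtain H :: "nat hypergraph" where "ex_L n wicket = card (edges H)" "linear_3_graph H"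
      "card (verts H) = n" "\<not> contains_copy H wicket"
      unfolding ex_L_def by blast
    then show "norm (real (ex_L n wicket)) \<le> c * norm ((real n)\<^sup>2)"
      using n0[of H] n by fastforce
  qed
next
  fix c :: real assume c: "c > 0"
  show "\<exists>n0::nat. \<forall>n\<ge>n0. \<forall>H :: 'a hypergraph.
       linear_3_graph H \<and> card (verts H) = n \<and> \<not> contains_copy H wicket
         \<longrightarrow> real (card (edges H)) < c * (real n)\<^sup>2"
    using dense_linear_3_graph_contains_wicket[OF c, where ?'a = 'a] by (metis not_le)
qed

end
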